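(* Let $F$ be the finite field of order $q$ and let $1\le k\le n$ be integers. Then, as polynomials in $\mathbb{Z}[T]$, $$g_{n,k}(T)=(T;q)_k\;A_{n-k}(q^kT).$$
   Context: For $\alpha\in F$, $f_{n,r,k}^{\alpha}$ is the number of $n\times n$ matrices $X=(x_{ij})$ over $F$ of rank $r$ with $x_{11}+\dots+x_{kk}=\alpha$. Put $g_{n,r,k}=f_{n,r,k}^{0}-f_{n,r,k}^{1}$ and $g_{n,k}(T)=\sum_{r=0}^{n}g_{n,r,k}T^{r}\in\mathbb{Z}[T]$. Let $a(N,r,q)$ be the number of $N\times N$ matrices of rank $r$ over $F$ (with $a(0,0,q)=1$) and $A_N(T)=\sum_{r=0}^{N}a(N,r,q)T^{r}$. The $q$-Pochhammer symbol is $(T;q)_k=\prod_{i=0}^{k-1}(1-Tq^{i})$. *)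

theory Defs
  imports
    "Jordan_Normal_Form.DL_Rank"
    "HOL-Computational_Algebra.Polynomial"
    "HOL-Library.Cardinality"
begin

text \<open>
  The finite field \<open>F\<close> is a type \<open>'a :: {field, finite}\<close> of cardinality \<open>q = CARD('a)\<close>.
  Matrix indices are 0-based, so \<open>x\<^sub>1\<^sub>1 + \<dots> + x\<^sub>k\<^sub>k\<close> is the sum of the
  entries \<open>(i, i)\<close> with \<open>i < k\<close>.
\<close>

definition rank_count_trace :: "'a :: {field, finite} \<Rightarrow> nat \<Rightarrow> nat \<Rightarrow> nat \<Rightarrow> nat" where
  "rank_count_trace \<alpha> n r k =
     card {X \<in> carrier_mat n n. vec_space.rank n X = r \<and> (\<Sum>i<k. X $$ (i, i)) = \<alpha>}"

text \<open>
  The following quantities depend on \<open>F\<close> but their values do not mention it, so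
  \<open>F\<close> is passed as a type argument.
\<close>

definition rank_diff :: "'a :: {field, finite} itself \<Rightarrow> nat \<Rightarrow> nat \<Rightarrow> nat \<Rightarrow> int" where
  "rank_diff _ n r k =
     int (rank_count_trace (0 :: 'a) n r k) - int (rank_count_trace (1 :: 'a) n r k)"

definition rank_diff_poly :: "'a :: {field, finite} itself \<Rightarrow> nat \<Rightarrow> nat \<Rightarrow> int poly" where
  "rank_diff_poly F n k = (\<Sum>r\<le>n. monom (rank_diff F n r k) r)"

definition rank_count :: "'a :: {field, finite} itself \<Rightarrow> nat \<Rightarrow> nat \<Rightarrow> nat" where
  "rank_count _ N r = card {X :: 'a mat. X \<in> carrier_mat N N \<and> vec_space.rank N X = r}"

definition rank_poly :: "'a :: {field, finite} itself \<Rightarrow> nat \<Rightarrow> int poly" where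
  "rank_poly F N = (\<Sum>r\<le>N. monom (int (rank_count F N r)) r)"

definition q_pochhammer :: "'b :: comm_ring_1 \<Rightarrow> 'b \<Rightarrow> nat \<Rightarrow> 'b" where
  "q_pochhammer a q k = (\<Prod>i<k. 1 - a * q ^ i)"

text \<open>No special convention is needed for \<open>0 \<times> 0\<close> matrices: there is exactly one, of rank 0.\<close>

lemma rank_count_0_0: "rank_count TYPE('a :: {field, finite}) 0 0 = 1"
proof -
  have "vec_space.rank 0 X = 0" if "X \<in> carrier_mat 0 0" for X :: "'a mat"
  proof -
    interpret vec_space "TYPE('a)" 0 .
    show ?thesis using rank_le_nc[OF that] by simp
  qed
  moreover have "carrier_mat 0 0 = {0\<^sub>m 0 0 :: 'a mat}" by auto
  ultimately have "{X :: 'a mat. X \<in> carrier_mat 0 0 \<and> vec_space.rank 0 X = 0} = {0\<^sub>m 0 0}" by auto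
  then show ?thesis unfolding rank_count_def by simp
qed

end

theory Submission
  imports Defs
begin

text \<open>
  The theorem is the \<open>k\<close>-fold iteration of the single recursion
  \<open>g\<^bsub>n+1,k+1\<^esub>(T) = (1 - T) g\<^bsub>n,k\<^esub>(qT)\<close>, started from \<open>g\<^bsub>n,0\<^esub> = A\<^sub>n\<close>
  (an empty trace is never 1); the factors \<open>1 - T\<close>, \<open>1 - qT\<close>, ... collect
  to the \<open>q\<close>-Pochhammer symbol.

  For the recursion, write \<open>g\<^bsub>n,k\<^esub>(T)\<close> as the sum of
  \<open>w(x\<^bsub>11\<^esub> + ... + x\<^bsub>kk\<^esub>) T\<^bsup>rank X\<^esup>\<close> over all \<open>X\<close>, where \<open>w(0) = 1\<close>,
  \<open>w(1) = -1\<close> and \<open>w\<close> vanishes elsewhere. What drives the recursion is that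
  the values of \<open>w\<close> add up to 0: the sum of \<open>w\<close> over a quantity that takes every value in \<open>F\<close>
  equally often is 0. Split off the first column, \<open>X = [c | W]\<close>, and fix \<open>W\<close>. The
  partial trace is \<open>c\<^sub>0 + t\<close> with \<open>t\<close> determined by \<open>W\<close>, and the rank is
  \<open>rank W\<close> or \<open>rank W + 1\<close> according to whether \<open>c\<close> lies in the column space \<open>S\<close>
  of \<open>W\<close>. Since \<open>c\<^sub>0\<close> is equidistributed over all columns \<open>c\<close>, the sum over \<open>c\<close>
  collapses to \<open>(1 - T) T\<^bsup>rank W\<^esup>\<close> times the sum of \<open>w(c\<^sub>0 + t)\<close> over
  \<open>c \<in> S\<close> (\<open>sum_adjoin_column\<close>).

  If the first row of \<open>W\<close> is nonzero, then \<open>c\<^sub>0\<close> is equidistributed on \<open>S\<close> as well and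
  nothing is left. If it is zero, then \<open>c\<^sub>0 = 0\<close> on \<open>S\<close>, and the sum is
  \<open>q\<^bsup>rank W\<^esup> w(t)\<close> (\<open>sum_first_coordinate_col_space\<close>). The surviving \<open>W\<close> are the
  \<open>n \<times> n\<close> matrices \<open>Y\<close> with a zero row put on top; this changes neither the rank nor the
  role of \<open>t\<close> as partial trace of \<open>Y\<close>, so what remains is
  \<open>(1 - T)\<close> times the sum of \<open>w(t) (qT)\<^bsup>rank Y\<^esup>\<close>.
\<close>

section \<open>Spans over a finite field\<close>

lemma finite_carrier_mat: "finite (carrier_mat m n :: 'a :: finite mat set)"
proof (rule finite_subset)
  show "(carrier_mat m n :: 'a mat set) \<subseteq> mat m n ` (({..<m} \<times> {..<n}) \<rightarrow>\<^sub>E UNIV)"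
  proof
    fix A :: "'a mat" assume "A \<in> carrier_mat m n"
    then have "A = mat m n (restrict (\<lambda>(i, j). A $$ (i, j)) ({..<m} \<times> {..<n}))"
      by (intro eq_matI) auto
    then show "A \<in> mat m n ` (({..<m} \<times> {..<n}) \<rightarrow>\<^sub>E UNIV)"
      by (intro image_eqI[where x = "restrict (\<lambda>(i, j). A $$ (i, j)) ({..<m} \<times> {..<n})"]) auto
  qed
qed (intro finite_imageI finite_PiE; simp)

lemma finite_carrier_vec: "finite (carrier_vec n :: 'a :: finite vec set)"
proof (rule finite_subset)
  show "(carrier_vec n :: 'a vec set) \<subseteq> (\<lambda>A. col A 0) ` carrier_mat n 1"
  proof
    fix v :: "'a vec" assume "v \<in> carrier_vec n"
    then have "v = col (mat n 1 (\<lambda>(i, j). v $ i)) 0"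
      by (intro eq_vecI) auto
    then show "v \<in> (\<lambda>A. col A 0) ` carrier_mat n 1"
      by (intro image_eqI[where x = "mat n 1 (\<lambda>(i, j). v $ i)"]) auto
  qed
qed (intro finite_imageI finite_carrier_mat)

context vec_space
begin

lemma span_insert_image:
  assumes "finite S" "S \<subseteq> carrier_vec n" "c \<in> carrier_vec n"
  shows "span (insert c S) = (\<lambda>(a, v). a \<cdot>\<^sub>v c + v) ` (UNIV \<times> span S)"
proof (cases "c \<in> S")
  case False
  have ins: "insert c S \<subseteq> carrier_vec n" and fin: "finite (insert c S)"
    using assms by auto
  show ?thesis
  proof (intro equalityI subsetI)
    fix x assume "x \<in> span (insert c S)"
    then obtain a where x: "x = lincomb a (insert c S)"
      unfolding finite_span[OF fin ins] by auto
    have "x = a c \<cdot>\<^sub>v c + lincomb a S"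
      unfolding x using lincomb_insert2[OF assms(1,2) _ False assms(3), of a] by simp
    moreover have "lincomb a S \<in> span S" using assms(1) by blast
    ultimately show "x \<in> (\<lambda>(a, v). a \<cdot>\<^sub>v c + v) ` (UNIV \<times> span S)" by auto
  next
    fix x assume "x \<in> (\<lambda>(a, v). a \<cdot>\<^sub>v c + v) ` (UNIV \<times> span S)"
    then obtain a v where x: "x = a \<cdot>\<^sub>v c + v" and v: "v \<in> span S" by auto
    have "v \<in> span (insert c S)" using v span_is_monotone[of S "insert c S"] by auto
    moreover have "a \<cdot>\<^sub>v c \<in> span (insert c S)"
      using smult_in_span[OF ins] span_mem[OF ins, of c] by simp
    ultimately show "x \<in> span (insert c S)" using span_add1[OF ins] x by simp
  qed
next
  case True
  then have ins: "insert c S = S" by auto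
  show ?thesis
  proof (intro equalityI subsetI)
    fix x assume x: "x \<in> span (insert c S)"
    then have "x \<in> carrier_vec n" using assms span_closed[of "insert c S"] by auto
    then have "x = 0 \<cdot>\<^sub>v c + x" using assms by (intro eq_vecI) auto
    then show "x \<in> (\<lambda>(a, v). a \<cdot>\<^sub>v c + v) ` (UNIV \<times> span S)"
      using x by (intro image_eqI[where x = "(0, x)"]) (simp_all add: ins)
  next
    fix x assume "x \<in> (\<lambda>(a, v). a \<cdot>\<^sub>v c + v) ` (UNIV \<times> span S)"
    then show "x \<in> span (insert c S)"
      using span_add1[OF assms(2)] smult_in_span[OF assms(2)] span_mem[OF assms(2) True] ins
      by auto
  qed
qed

lemma card_span_insert:
  assumes "finite S" "S \<subseteq> carrier_vec n" "c \<in> carrier_vec n" "c \<notin> span S"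
  shows "card (span (insert c S)) = CARD('a) * card (span S)"
proof -
  have "inj_on (\<lambda>(a, v). a \<cdot>\<^sub>v c + v) (UNIV \<times> span S)"
  proof (rule inj_onI, clarify)
    fix a b v w
    assume v: "v \<in> span S" and w: "w \<in> span S" and eq: "a \<cdot>\<^sub>v c + v = b \<cdot>\<^sub>v c + w"
    have vw: "v \<in> carrier_vec n" "w \<in> carrier_vec n" using span_closed assms v w by auto
    have idx: "a * c $ i + v $ i = b * c $ i + w $ i" if "i < n" for i
      using arg_cong[OF eq, of "\<lambda>x. x $ i"] that vw assms by simp
    have "a = b"
    proof (rule ccontr)
      assume ne: "a \<noteq> b"
      have "c = inverse (a - b) \<cdot>\<^sub>v (w + (- 1) \<cdot>\<^sub>v v)"
      proof (rule eq_vecI)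
        fix i assume "i < dim_vec (inverse (a - b) \<cdot>\<^sub>v (w + (- 1) \<cdot>\<^sub>v v))"
        then have i: "i < n" using vw by auto
        have "(a - b) * c $ i = w $ i - v $ i" using idx[OF i] by (simp add: algebra_simps)
        then have "c $ i = inverse (a - b) * (w $ i - v $ i)"
          using ne by (simp add: field_simps)
        then show "c $ i = (inverse (a - b) \<cdot>\<^sub>v (w + (- 1) \<cdot>\<^sub>v v)) $ i" using i vw by simp
      qed (use vw assms in auto)
      also have "\<dots> \<in> span S"
        by (intro smult_in_span[OF assms(2)] span_add1[OF assms(2), simplified] v w)
      finally show False using assms by simp
    qed
    moreover have "v = w"
      by (rule eq_vecI) (use idx \<open>a = b\<close> vw in auto)
    ultimately show "a = b \<and> v = w" by simp
  qed
  then show ?thesis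
    by (simp add: span_insert_image[OF assms(1-3)] card_image card_cartesian_product)
qed

text \<open>
  Adjoining a vector outside the span multiplies the size of the span by \<open>q\<close>, so a maximal
  independent subset gives a power of \<open>q\<close>. Below, ranks are compared by counting the elements of
  column spaces.
\<close>

lemma card_span:
  assumes "finite S" "S \<subseteq> carrier_vec n"
  shows "card (span S) = CARD('a) ^ vectorspace.dim class_ring (span_vs S)"
proof -
  obtain U where max: "maximal U (\<lambda>T. T \<subseteq> S \<and> lin_indpt T)"
    using maximal_exists_superset[OF assms(1), of "\<lambda>T. T \<subseteq> S \<and> lin_indpt T" "{}"]
    by (auto simp: lin_dep_def)
  then have US: "U \<subseteq> S" and ind: "lin_indpt U" unfolding maximal_def by auto
  have U: "U \<subseteq> carrier_vec n" "finite U" using US assms finite_subset by auto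
  have "span U = span S"
  proof
    show "span U \<subseteq> span S" using US by (rule span_is_monotone)
    have "s \<in> span U" if s: "s \<in> S" for s
    proof (rule ccontr)
      assume ns: "s \<notin> span U"
      have "s \<notin> U" using ns span_mem[OF U(1)[folded module_vec_simps(3)]] U by auto
      then have "lin_indpt (U \<union> {s})"
        using lin_dep_iff_in_span[of U s] U ind ns s assms by auto
      then have "U \<union> {s} = U" using max US s unfolding maximal_def by blast
      then show False using \<open>s \<notin> U\<close> by auto
    qed
    then show "span S \<subseteq> span U" by (intro span_subsetI U) auto
  qed
  have "card (span U) = CARD('a) ^ card U"
    using U(2,1) ind
  proof (induction U rule: finite_induct)
    case empty
    show ?case using span_empty by simp
  next
    case (insert u U)
    have U: "lin_indpt U" using subset_li_is_li[OF insert.prems(2)] by auto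
    have "u \<notin> span U"
      using lin_dep_iff_in_span[of U u] U insert by auto
    then show ?case
      using insert U by (simp add: card_span_insert)
  qed
  then show ?thesis
    using dim_span[OF _ assms(1) max] assms(2) \<open>span U = span S\<close> by simp
qed

lemma card_col_space:
  assumes "A \<in> carrier_mat n nc"
  shows "card (col_space A) = CARD('a) ^ rank A"
  unfolding rank_def col_space_def using assms cols_dim[of A] by (intro card_span) auto

lemma col_space_add_smult:
  assumes "A \<in> carrier_mat n nc" "y \<in> col_space A" "s \<in> col_space A"
  shows "y + a \<cdot>\<^sub>v s \<in> col_space A"
proof -
  have "set (cols A) \<subseteq> carrier_vec n" using assms(1) cols_dim[of A] by auto
  then show ?thesis
    using assms(2,3) span_add1 smult_in_span unfolding col_space_def by simp
qed

end

lemma one_less_card_field: "1 < CARD('a :: {field, finite})"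
  using card_mono[of "UNIV :: 'a set" "{0, 1}"] by simp

text \<open>
  A new column \<open>c\<close> in the column space leaves the span unchanged; otherwise it multiplies the
  number of its elements, which is \<open>q\<close> to the rank, by \<open>q\<close>.
\<close>

lemma rank_adjoin_column:
  fixes A :: "'a :: {field, finite} mat"
  assumes "A \<in> carrier_mat n nc" "c \<in> carrier_vec n"
  shows "vec_space.rank n (mat_of_cols n (c # cols A)) =
         vec_space.rank n A + (if c \<in> vec_space.col_space n A then 0 else 1)"
proof -
  interpret vec_space "TYPE('a)" n .
  let ?S = "set (cols A)"
  have S: "?S \<subseteq> carrier_vec n" using assms(1) cols_dim[of A] by auto
  have cols: "cols (mat_of_cols n (c # cols A)) = c # cols A"
    using S assms(2) by (intro cols_mat_of_cols) auto
  show ?thesis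
  proof (cases "c \<in> col_space A")
    case True
    have "span (insert c ?S) = span ?S"
    proof
      show "span (insert c ?S) \<subseteq> span ?S"
        using True in_own_span[of ?S] S unfolding col_space_def by (intro span_subsetI) auto
      show "span ?S \<subseteq> span (insert c ?S)" by (rule span_is_monotone) auto
    qed
    then show ?thesis using True by (simp add: rank_def cols)
  next
    case False
    have "CARD('a) ^ rank (mat_of_cols n (c # cols A)) = card (span (insert c ?S))"
      using card_col_space[of "mat_of_cols n (c # cols A)" "Suc (length (cols A))"]
        mat_of_cols_carrier(1)[of n "c # cols A"]
      by (simp add: col_space_def cols)
    also have "\<dots> = CARD('a) * card (span ?S)"
      using False assms S unfolding col_space_def by (intro card_span_insert) auto
    also have "\<dots> = CARD('a) ^ Suc (rank A)"
      using card_col_space[OF assms(1)] by (simp add: col_space_def)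
    finally show ?thesis
      using False unfolding power_inject_exp[OF one_less_card_field] by simp
  qed
qed

text \<open>
  The map \<open>vCons 0\<close> is linear, so it commutes with forming the span.
\<close>

lemma span_vCons_0:
  fixes S :: "'a :: {field, finite} vec set"
  assumes "finite S" "S \<subseteq> carrier_vec n"
  shows "LinearCombinations.module.span class_ring (module_vec TYPE('a) (Suc n)) (vCons 0 ` S) =
         vCons 0 ` LinearCombinations.module.span class_ring (module_vec TYPE('a) n) S"
proof -
  interpret V: vec_space "TYPE('a)" n .
  interpret W: vec_space "TYPE('a)" "Suc n" .
  show ?thesis
    using assms
  proof (induction S rule: finite_induct)
    case empty
    have "0\<^sub>v (Suc n) = vCons (0 :: 'a) (0\<^sub>v n)"
      by (rule eq_vecI) (auto simp: vec_index_vCons)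
    then show ?case using V.span_empty W.span_empty by simp
  next
    case (insert c S)
    have c: "c \<in> carrier_vec n" and S: "S \<subseteq> carrier_vec n" using insert by auto
    have span_S: "V.span S \<subseteq> carrier_vec n" using V.span_closed S by auto
    have vCons: "a \<cdot>\<^sub>v vCons 0 c + vCons 0 v = vCons 0 (a \<cdot>\<^sub>v c + v)" if "v \<in> V.span S" for a v
      using that span_S c by (intro eq_vecI) (auto simp: vec_index_vCons)
    have "W.span (vCons 0 ` insert c S) =
        (\<lambda>(a, v). a \<cdot>\<^sub>v vCons 0 c + v) ` (UNIV \<times> vCons 0 ` V.span S)"
      using insert(1,3) c S by (subst image_insert, subst W.span_insert_image) auto
    also have "\<dots> = vCons 0 ` (\<lambda>(a, v). a \<cdot>\<^sub>v c + v) ` (UNIV \<times> V.span S)"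
      using vCons by (force simp: image_iff)
    also have "\<dots> = vCons 0 ` V.span (insert c S)"
      using insert c S by (simp add: V.span_insert_image)
    finally show ?case .
  qed
qed

section \<open>Equidistribution of a coordinate\<close>

text \<open>
  Translation along \<open>s\<close> permutes \<open>S\<close> and shifts the \<open>i\<close>-th coordinate by any
  prescribed \<open>b\<close>. Hence the sum does not change when \<open>t\<close> is replaced by \<open>t + b\<close>, and its
  average over all \<open>b\<close> is 0 because \<open>w\<close> has total 0. The weight is integer valued, so the
  factor \<open>q\<close> from averaging can be cancelled.
\<close>

lemma sum_coordinate_eq_0:
  fixes w :: "'a :: {field, finite} \<Rightarrow> int"
  assumes w: "(\<Sum>a\<in>UNIV. w a) = 0"
    and S: "S \<subseteq> carrier_vec m" "i < m"
    and s: "s \<in> S" "s $ i \<noteq> 0"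
    and closed: "\<And>y a. y \<in> S \<Longrightarrow> y + a \<cdot>\<^sub>v s \<in> S"
  shows "(\<Sum>y\<in>S. w (y $ i + t)) = 0"
proof -
  have shift: "(\<Sum>y\<in>S. w (y $ i + b + t)) = (\<Sum>y\<in>S. w (y $ i + t))" for b
  proof (rule sum.reindex_bij_witness[where i = "\<lambda>y. y + (- b / s $ i) \<cdot>\<^sub>v s"
        and j = "\<lambda>y. y + (b / s $ i) \<cdot>\<^sub>v s"])
    have sm: "s \<in> carrier_vec m" using S s by auto
    fix y assume y: "y \<in> S"
    then have ym: "y \<in> carrier_vec m" using S by auto
    show "y + (b / s $ i) \<cdot>\<^sub>v s + (- b / s $ i) \<cdot>\<^sub>v s = y"
      and "y + (- b / s $ i) \<cdot>\<^sub>v s + (b / s $ i) \<cdot>\<^sub>v s = y"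
      using ym sm by (auto intro!: eq_vecI)
    show "w ((y + (b / s $ i) \<cdot>\<^sub>v s) $ i + t) = w (y $ i + b + t)"
      using ym sm S(2) s(2) by simp
  qed (use closed in auto)
  \<comment> \<open>Average over all shifts \<open>b\<close> and exchange the two sums.\<close>
  have "int CARD('a) * (\<Sum>y\<in>S. w (y $ i + t)) = (\<Sum>b\<in>(UNIV :: 'a set). \<Sum>y\<in>S. w (y $ i + b + t))"
    by (simp add: shift)
  also have "\<dots> = (\<Sum>y\<in>S. \<Sum>b\<in>UNIV. w (y $ i + b + t))"
    by (rule sum.swap)
  also have "\<dots> = (\<Sum>y\<in>S. \<Sum>b\<in>UNIV. w b)"
  proof (rule sum.cong[OF refl])
    fix y
    show "(\<Sum>b\<in>UNIV. w (y $ i + b + t)) = (\<Sum>b\<in>UNIV. w b)"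
      by (rule sum.reindex_bij_witness[where i = "\<lambda>b. b - y $ i - t" and j = "\<lambda>b. y $ i + b + t"]) auto
  qed
  finally show ?thesis using w by simp
qed

section \<open>Peeling off a row and a column\<close>

lemma sum_carrier_mat_Suc:
  fixes f :: "'a mat \<Rightarrow> 'b :: comm_monoid_add"
  shows "(\<Sum>X\<in>carrier_mat m (Suc n). f X) =
   (\<Sum>W\<in>carrier_mat m n. \<Sum>c\<in>carrier_vec m. f (mat_of_cols m (c # cols W)))"
proof -
  have cols: "cols (mat_of_cols m (c # cols W)) = c # cols W"
    if "W \<in> carrier_mat m n" "c \<in> carrier_vec m" for W and c :: "'a vec"
    using that cols_dim[of W] by (intro cols_mat_of_cols) auto
  have "(\<Sum>X\<in>carrier_mat m (Suc n). f X) =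
      (\<Sum>(W, c)\<in>carrier_mat m n \<times> carrier_vec m. f (mat_of_cols m (c # cols W)))"
  proof (rule sum.reindex_bij_witness[where i = "\<lambda>(W, c). mat_of_cols m (c # cols W)"
        and j = "\<lambda>X. (mat_of_cols m (tl (cols X)), hd (cols X))"])
    fix X :: "'a mat" assume X: "X \<in> carrier_mat m (Suc n)"
    then have "length (cols X) = Suc n" by simp
    then obtain c cs where cs: "cols X = c # cs" "length cs = n"
      unfolding length_Suc_conv by blast
    have dims: "c \<in> carrier_vec m" "set cs \<subseteq> carrier_vec m"
      using cols_dim[of X] cs X by auto
    show eq: "(case (mat_of_cols m (tl (cols X)), hd (cols X)) of (W, c) \<Rightarrow> mat_of_cols m (c # cols W)) = X"
      using X dims by (simp add: cs) (metis carrier_matD(1) cs(1) mat_of_cols_cols)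
    show "(mat_of_cols m (tl (cols X)), hd (cols X)) \<in> carrier_mat m n \<times> carrier_vec m"
      using cs dims mat_of_cols_carrier(1)[of m cs] by simp
    show "(case (mat_of_cols m (tl (cols X)), hd (cols X)) of (W, c) \<Rightarrow> f (mat_of_cols m (c # cols W))) = f X"
      using eq by simp
  next
    fix p :: "'a mat \<times> 'a vec" assume p: "p \<in> carrier_mat m n \<times> carrier_vec m"
    then show "(mat_of_cols m (tl (cols (case p of (W, c) \<Rightarrow> mat_of_cols m (c # cols W)))),
        hd (cols (case p of (W, c) \<Rightarrow> mat_of_cols m (c # cols W)))) = p"
      using mat_of_cols_cols[of "fst p"] by (auto simp: cols)
    show "(case p of (W, c) \<Rightarrow> mat_of_cols m (c # cols W)) \<in> carrier_mat m (Suc n)"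
      using p by (auto intro!: carrier_matI)
  qed
  then show ?thesis by (simp add: sum.cartesian_product)
qed

abbreviation adjoin_zero_row :: "nat \<Rightarrow> 'a :: zero mat \<Rightarrow> 'a mat" where
  "adjoin_zero_row n Y \<equiv> mat_of_cols (Suc n) (map (vCons 0) (cols Y))"

lemma adjoin_zero_row_index:
  assumes "Y \<in> carrier_mat n nc" "j < nc"
  shows "i < n \<Longrightarrow> adjoin_zero_row n Y $$ (Suc i, j) = Y $$ (i, j)"
    and "adjoin_zero_row n Y $$ (0, j) = 0"
  using assms by (auto simp: mat_of_cols_index)

lemma col_space_adjoin_zero_row:
  fixes Y :: "'a :: {field, finite} mat"
  assumes "Y \<in> carrier_mat n nc"
  shows "vec_space.col_space (Suc n) (adjoin_zero_row n Y) = vCons 0 ` vec_space.col_space n Y"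
proof -
  interpret V: vec_space "TYPE('a)" n .
  interpret W: vec_space "TYPE('a)" "Suc n" .
  have Y: "set (cols Y) \<subseteq> carrier_vec n" using assms cols_dim[of Y] by auto
  then have "cols (adjoin_zero_row n Y) = map (vCons 0) (cols Y)"
    by (intro cols_mat_of_cols) auto
  then show ?thesis
    unfolding V.col_space_def W.col_space_def using span_vCons_0[OF _ Y] by simp
qed

text \<open>
  The column spaces are in bijection under the injection \<open>vCons 0\<close>, so they have the same number
  of elements, and that number determines the rank.
\<close>

lemma rank_adjoin_zero_row:
  fixes Y :: "'a :: {field, finite} mat"
  assumes "Y \<in> carrier_mat n nc"
  shows "vec_space.rank (Suc n) (adjoin_zero_row n Y) = vec_space.rank n Y"
proof -
  interpret V: vec_space "TYPE('a)" n .
  interpret W: vec_space "TYPE('a)" "Suc n" .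
  have "inj_on (vCons (0 :: 'a)) (V.col_space Y)"
  proof (rule inj_onI)
    fix v w :: "'a vec" assume eq: "vCons 0 v = vCons 0 w"
    show "v = w"
    proof (rule eq_vecI)
      show "v $ i = w $ i" for i using arg_cong[OF eq, of "\<lambda>x. x $ Suc i"] by simp
      show "dim_vec v = dim_vec w" using arg_cong[OF eq, of dim_vec] by simp
    qed
  qed
  then have "card (W.col_space (adjoin_zero_row n Y)) = card (V.col_space Y)"
    by (simp add: col_space_adjoin_zero_row[OF assms] card_image)
  moreover have "adjoin_zero_row n Y \<in> carrier_mat (Suc n) nc"
    using assms by (intro carrier_matI) auto
  ultimately show ?thesis
    using one_less_card_field[where 'a = 'a] by (simp add: V.card_col_space[OF assms] W.card_col_space)
qed

lemma sum_zero_first_row: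
  fixes f :: "'a :: zero mat \<Rightarrow> 'b :: comm_monoid_add"
  shows "(\<Sum>W | W \<in> carrier_mat (Suc n) nc \<and> row W 0 = 0\<^sub>v nc. f W) =
   (\<Sum>Y\<in>carrier_mat n nc. f (adjoin_zero_row n Y))"
proof (rule sum.reindex_bij_witness[where i = "adjoin_zero_row n"
      and j = "\<lambda>W. mat n nc (\<lambda>(i, j). W $$ (Suc i, j))"])
  fix W :: "'a mat" assume W: "W \<in> {W. W \<in> carrier_mat (Suc n) nc \<and> row W 0 = 0\<^sub>v nc}"
  have first: "W $$ (0, j) = 0" if "j < nc" for j
  proof -
    have "row W 0 $ j = 0\<^sub>v nc $ j" using W by simp
    then show ?thesis using W that by (subst (asm) index_row) auto
  qed
  show eq: "adjoin_zero_row n (mat n nc (\<lambda>(i, j). W $$ (Suc i, j))) = W"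
  proof (rule eq_matI)
    fix i j assume "i < dim_row W" "j < dim_col W"
    then show "adjoin_zero_row n (mat n nc (\<lambda>(i, j). W $$ (Suc i, j))) $$ (i, j) = W $$ (i, j)"
      using W first
      by (cases i) (auto simp: adjoin_zero_row_index[where nc = nc])
  qed (use W in auto)
  show "f (adjoin_zero_row n (mat n nc (\<lambda>(i, j). W $$ (Suc i, j)))) = f W"
    using eq by simp
next
  fix Y :: "'a mat" assume Y: "Y \<in> carrier_mat n nc"
  show "mat n nc (\<lambda>(i, j). adjoin_zero_row n Y $$ (Suc i, j)) = Y"
    using Y by (intro eq_matI) (auto simp: adjoin_zero_row_index[where nc = nc])
  show "adjoin_zero_row n Y \<in> {W. W \<in> carrier_mat (Suc n) nc \<and> row W 0 = 0\<^sub>v nc}"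
    using Y by (auto intro!: carrier_matI eq_vecI simp: adjoin_zero_row_index[where nc = nc])
qed auto


section \<open>The recursion\<close>

text \<open>
  The polynomial \<open>g\<^bsub>n,k\<^esub>\<close> for an arbitrary weight \<open>w\<close> in place of
  (indicator of 0) - (indicator of 1), written as one sum over matrices. The recursion holds for
  every \<open>w\<close> of total 0.
\<close>

definition trace_weight_poly :: "('a :: {field, finite} \<Rightarrow> int) \<Rightarrow> nat \<Rightarrow> nat \<Rightarrow> int poly" where
  "trace_weight_poly w n k =
     (\<Sum>X\<in>carrier_mat n n. monom (w (\<Sum>i<k. X $$ (i, i))) (vec_space.rank n X))"

text \<open>
  Give every \<open>c\<close> the rank \<open>rank W + 1\<close> first; that sum vanishes by equidistribution of
  \<open>c\<^sub>0\<close> on the whole space. The correction is needed exactly for \<open>c\<close> in the column space of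
  \<open>W\<close>, where \<open>T\<^bsup>rank W + 1\<^esup>\<close> is replaced by \<open>T\<^bsup>rank W\<^esup>\<close>, that is, by adding
  \<open>(1 - T) T\<^bsup>rank W\<^esup>\<close>.
\<close>

lemma sum_adjoin_column:
  fixes w :: "'a :: {field, finite} \<Rightarrow> int"
  assumes w: "(\<Sum>a\<in>UNIV. w a) = 0" and W: "W \<in> carrier_mat m nc" and m: "0 < m"
  shows "(\<Sum>c\<in>carrier_vec m. monom (w (c $ 0 + t)) (vec_space.rank m (mat_of_cols m (c # cols W)))) =
         [:1, -1:] * monom (\<Sum>c\<in>vec_space.col_space m W. w (c $ 0 + t)) (vec_space.rank m W)"
proof -
  interpret vec_space "TYPE('a)" m .
  let ?r = "rank W" and ?S = "col_space W"
  have S: "?S \<subseteq> carrier_vec m"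
    using col_space_eq[OF W] W by auto
  have all: "(\<Sum>c\<in>carrier_vec m. w (c $ 0 + t)) = 0"
    using w m by (intro sum_coordinate_eq_0[where s = "unit_vec m 0" and m = m]) auto
  have "(\<Sum>c\<in>carrier_vec m. monom (w (c $ 0 + t)) (rank (mat_of_cols m (c # cols W)))) =
      (\<Sum>c\<in>carrier_vec m. monom (w (c $ 0 + t)) (Suc ?r) +
        (if c \<in> ?S then [:1, -1:] * monom (w (c $ 0 + t)) ?r else 0))"
  proof (rule sum.cong[OF refl])
    fix c :: "'a vec" assume "c \<in> carrier_vec m"
    then show "monom (w (c $ 0 + t)) (rank (mat_of_cols m (c # cols W))) =
        monom (w (c $ 0 + t)) (Suc ?r) + (if c \<in> ?S then [:1, -1:] * monom (w (c $ 0 + t)) ?r else 0)"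
      using rank_adjoin_column[OF W] by (simp add: monom_Suc)
  qed
  also have "\<dots> = monom (\<Sum>c\<in>carrier_vec m. w (c $ 0 + t)) (Suc ?r) +
      [:1, -1:] * monom (\<Sum>c\<in>?S. w (c $ 0 + t)) ?r"
    using S by (simp add: sum.distrib monom_sum sum_distrib_left Int_absorb1
        sum.inter_restrict[symmetric] finite_carrier_vec del: mult_pCons_left)
  finally show ?thesis by (simp add: all)
qed

text \<open>
  The first coordinate of \<open>W x\<close> is the product of the first row of \<open>W\<close> with \<open>x\<close>. It
  vanishes on the whole column space if that row is zero. If entry \<open>j\<close> of the row is nonzero, column \<open>j\<close> is a
  direction in the column space along which the first coordinate takes all values.
\<close>

lemma sum_first_coordinate_col_space:
  fixes w :: "'a :: {field, finite} \<Rightarrow> int"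
  assumes w: "(\<Sum>a\<in>UNIV. w a) = 0" and W: "W \<in> carrier_mat (Suc n) nc"
  shows "(\<Sum>c\<in>vec_space.col_space (Suc n) W. w (c $ 0 + t)) =
         (if row W 0 = 0\<^sub>v nc then int CARD('a) ^ vec_space.rank (Suc n) W * w t else 0)"
proof -
  interpret vec_space "TYPE('a)" "Suc n" .
  have S: "col_space W \<subseteq> carrier_vec (Suc n)"
    using col_space_eq[OF W] W by auto
  show ?thesis
  proof (cases "row W 0 = 0\<^sub>v nc")
    case True
    have "c $ 0 = 0" if c: "c \<in> col_space W" for c
    proof -
      obtain x where x: "x \<in> carrier_vec nc" and "c = W *\<^sub>v x"
        using c W by (auto simp: col_space_eq[OF W])
      then have "c $ 0 = row W 0 \<bullet> x" using W by simp
      then show ?thesis using x by (simp add: True)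
    qed
    then show ?thesis
      by (simp add: True card_col_space[OF W])
  next
    case False
    then obtain j where j: "j < nc" "W $$ (0, j) \<noteq> 0"
      using W by (auto simp: vec_eq_iff)
    have "col W j \<in> col_space W"
    proof -
      have "col W j \<in> set (cols W)" using W j by (auto simp: cols_def)
      then show ?thesis
        using in_own_span[of "set (cols W)"] cols_dim[of W] W unfolding col_space_def by auto
    qed
    then have "(\<Sum>c\<in>col_space W. w (c $ 0 + t)) = 0"
      using j W S by (intro sum_coordinate_eq_0[OF w, where s = "col W j" and m = "Suc n"])
        (auto intro: col_space_add_smult[OF W])
    then show ?thesis using False by simp
  qed
qed

text \<open>
  The hypothesis \<open>k \<le> n\<close> ensures that the \<open>k + 1\<close> diagonal entries exist: the first one is the
  top entry of the first column, the others form the partial trace of the matrix left after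
  deleting the first row and column.
\<close>

lemma trace_weight_poly_Suc:
  fixes w :: "'a :: {field, finite} \<Rightarrow> int"
  assumes w: "(\<Sum>a\<in>UNIV. w a) = 0" and "k \<le> n"
  shows "trace_weight_poly w (Suc n) (Suc k) =
         [:1, -1:] * (trace_weight_poly w n k \<circ>\<^sub>p [:0, int CARD('a):])"
proof -
  let ?M = "carrier_mat (Suc n) n :: 'a mat set"
  define t where "t W = (\<Sum>i<k. W $$ (Suc i, i))" for W :: "'a mat"
  let ?g = "\<lambda>W. [:1, -1:] * monom (int CARD('a) ^ vec_space.rank (Suc n) W * w (t W)) (vec_space.rank (Suc n) W)"
  have trace: "(\<Sum>i<Suc k. mat_of_cols (Suc n) (c # cols W) $$ (i, i)) = c $ 0 + t W"
    if "W \<in> ?M" for c W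
  proof -
    have "mat_of_cols (Suc n) (c # cols W) $$ (Suc i, Suc i) = W $$ (Suc i, i)" if "i < k" for i
      using that \<open>W \<in> ?M\<close> assms(2) by (simp add: mat_of_cols_index)
    then show ?thesis
      by (simp add: sum.lessThan_Suc_shift t_def mat_of_cols_Cons_index_0 del: sum.lessThan_Suc)
  qed
  have "trace_weight_poly w (Suc n) (Suc k) =
      (\<Sum>W\<in>?M. \<Sum>c\<in>carrier_vec (Suc n). monom (w (c $ 0 + t W))
        (vec_space.rank (Suc n) (mat_of_cols (Suc n) (c # cols W))))"
    unfolding trace_weight_poly_def sum_carrier_mat_Suc
    by (intro sum.cong refl) (simp only: trace)
  also have "\<dots> = (\<Sum>W\<in>?M. [:1, -1:] *
      monom (\<Sum>c\<in>vec_space.col_space (Suc n) W. w (c $ 0 + t W)) (vec_space.rank (Suc n) W))"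
    by (intro sum.cong refl sum_adjoin_column w) auto
  also have "\<dots> = (\<Sum>W\<in>?M. if row W 0 = 0\<^sub>v n then ?g W else 0)"
    by (intro sum.cong refl) (simp add: sum_first_coordinate_col_space[OF w])
  also have "\<dots> = (\<Sum>W | W \<in> ?M \<and> row W 0 = 0\<^sub>v n. ?g W)"
    by (rule sum.inter_filter[symmetric]) (rule finite_carrier_mat)
  also have "\<dots> = (\<Sum>Y\<in>carrier_mat n n. ?g (adjoin_zero_row n Y))"
    by (rule sum_zero_first_row)
  also have "\<dots> = (\<Sum>Y\<in>carrier_mat n n. [:1, -1:] *
      (monom (w (\<Sum>i<k. Y $$ (i, i))) (vec_space.rank n Y) \<circ>\<^sub>p [:0, int CARD('a):]))"
  proof (rule sum.cong[OF refl])
    fix Y :: "'a mat" assume Y: "Y \<in> carrier_mat n n"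
    have "t (adjoin_zero_row n Y) = (\<Sum>i<k. Y $$ (i, i))"
      unfolding t_def using assms(2) by (intro sum.cong refl adjoin_zero_row_index[OF Y]) auto
    moreover have "monom a r \<circ>\<^sub>p [:0, b:] = monom (b ^ r * a) r" for a b :: int and r
      by (induction r) (simp_all add: monom_0 monom_Suc pcompose_pCons smult_monom)
    ultimately show "?g (adjoin_zero_row n Y) = [:1, -1:] *
      (monom (w (\<Sum>i<k. Y $$ (i, i))) (vec_space.rank n Y) \<circ>\<^sub>p [:0, int CARD('a):])"
      by (simp only: rank_adjoin_zero_row[OF Y])
  qed
  also have "\<dots> = [:1, -1:] * (trace_weight_poly w n k \<circ>\<^sub>p [:0, int CARD('a):])"
    by (simp only: trace_weight_poly_def pcompose_sum sum_distrib_left)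
  finally show ?thesis .
qed

section \<open>The factorization\<close>

lemma rank_diff_poly_eq_trace_weight_poly:
  "rank_diff_poly TYPE('a :: {field, finite}) n k =
   trace_weight_poly (\<lambda>a :: 'a. of_bool (a = 0) - of_bool (a = 1)) n k"
proof -
  let ?C = "carrier_mat n n :: 'a mat set"
  let ?tr = "\<lambda>X :: 'a mat. \<Sum>i<k. X $$ (i, i)"
  have fin: "finite ?C" by (rule finite_carrier_mat)
  have count: "int (rank_count_trace a n r k) =
      (\<Sum>X | X \<in> ?C \<and> vec_space.rank n X = r. of_bool (?tr X = a))" for a r
  proof -
    have "{X \<in> ?C. vec_space.rank n X = r \<and> ?tr X = a} =
        {X. X \<in> ?C \<and> vec_space.rank n X = r} \<inter> {X. ?tr X = a}" by auto
    then show ?thesis using fin by (simp add: rank_count_trace_def of_bool_def sum.If_cases)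
  qed
  have rank: "vec_space.rank n X \<le> n" if "X \<in> ?C" for X
    using vec_space.rank_le_nc[OF that] .
  have "rank_diff_poly TYPE('a) n k =
      (\<Sum>r\<le>n. \<Sum>X | X \<in> ?C \<and> vec_space.rank n X = r.
        monom (of_bool (?tr X = 0) - of_bool (?tr X = 1)) (vec_space.rank n X))"
    unfolding rank_diff_poly_def rank_diff_def count
    by (intro sum.cong refl) (simp add: monom_sum sum_subtractf flip: diff_monom)
  also have "\<dots> = trace_weight_poly (\<lambda>a :: 'a. of_bool (a = 0) - of_bool (a = 1)) n k"
    unfolding trace_weight_poly_def using rank by (intro sum.group fin) auto
  finally show ?thesis .
qed

lemma rank_diff_poly_0: "rank_diff_poly F n 0 = rank_poly F n"
  by (simp add: rank_diff_poly_def rank_poly_def rank_diff_def rank_count_trace_def rank_count_def)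

lemma rank_diff_poly_Suc:
  assumes "k \<le> n"
  shows "rank_diff_poly TYPE('a :: {field, finite}) (Suc n) (Suc k) =
         [:1, -1:] * (rank_diff_poly TYPE('a) n k \<circ>\<^sub>p [:0, int CARD('a):])"
  unfolding rank_diff_poly_eq_trace_weight_poly using assms
  by (intro trace_weight_poly_Suc) (simp_all add: sum_subtractf of_bool_def)

lemma q_pochhammer_Suc:
  "q_pochhammer [:0, 1:] (of_nat q) (Suc k) =
   [:1, -1:] * (q_pochhammer [:0, 1:] (of_nat q) k \<circ>\<^sub>p [:0, int q:])"
proof -
  have "(1 - [:0, 1:] * of_nat q ^ i) \<circ>\<^sub>p [:0, int q:] = 1 - [:0, 1:] * of_nat q ^ Suc i" for i
  proof -
    have "(of_nat q ^ j :: int poly) = [:int q ^ j:]" for j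
      by (simp add: of_nat_poly poly_const_pow)
    then show ?thesis by (simp add: pcompose_diff pcompose_pCons one_pCons of_nat_poly mult.commute)
  qed
  then show ?thesis
    unfolding q_pochhammer_def by (simp add: prod.lessThan_Suc_shift pcompose_prod one_pCons del: prod.lessThan_Suc)
qed

lemma rank_diff_poly_factorization:
  assumes "k \<le> n"
  shows "rank_diff_poly TYPE('a :: {field, finite}) n k =
         q_pochhammer [:0, 1:] (of_nat CARD('a)) k *
         (rank_poly TYPE('a) (n - k) \<circ>\<^sub>p [:0, int CARD('a) ^ k:])"
  using assms
proof (induction k arbitrary: n)
  case 0
  then show ?case by (simp add: rank_diff_poly_0 q_pochhammer_def)
next
  case (Suc k)
  then obtain n' where n: "n = Suc n'" "k \<le> n'" by (cases n) auto
  \<comment> \<open>Substituting \<open>qT\<close> into \<open>q\<^sup>kT\<close> supplies the missing power of \<open>q\<close>.\<close>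
  have "[:0, int CARD('a) ^ k:] \<circ>\<^sub>p [:0, int CARD('a):] = [:0, int CARD('a) ^ Suc k:]"
    by (simp add: pcompose_pCons mult.commute)
  then show ?case
    using Suc.IH[OF n(2)] n
    by (simp add: rank_diff_poly_Suc q_pochhammer_Suc pcompose_mult pcompose_assoc[symmetric] mult.assoc
        del: mult_pCons_left)
qed

theorem theorem3p4:
  fixes n k q :: nat
  assumes "q = CARD('a)"
    and "1 \<le> k" and "k \<le> n"
  shows "rank_diff_poly TYPE('a :: {field, finite}) n k =
         q_pochhammer [:0, 1:] (of_nat q) k *
         (rank_poly TYPE('a) (n - k) \<circ>\<^sub>p [:0, int q ^ k:])"
  using rank_diff_poly_factorization[OF assms(3), where 'a = 'a] assms(1) by simp

end
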